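(* Let $\bar S$ be an Assmus–Mattson Steiner triple system of order $N\ge 99$. Then $\bar S$ admits a zero-sum $5$-flow, i.e. there is a vector $v$ indexed by the blocks of $\bar S$, with all entries in $\{\pm1,\pm2,\pm3,\pm4\}$, such that $\sum_{T\in\bar S,\ x\in T} v_T=0$ for every point $x$ of $\bar S$.
   Context: A Steiner triple system (STS) of order $n$ is a collection $S$ of $3$-subsets (blocks) of $\{1,\dots,n\}$ such that every $2$-subset lies in exactly one block. Assmus–Mattson construction: given an STS $S$ of order $n$ on $\{1,\dots,n\}$ and a function $\tau:S\to\{0,1\}$, take the point set $\{1,\dots,n,\bar1,\dots,\bar n,2n+1\}$ (where $\bar i$ denotes $i+n$). For each block $\{i,j,k\}\in S$ with $\tau(\{i,j,k\})=0$ include the four blocks $\{i,j,k\},\{i,\bar j,\bar k\},\{\bar i,j,\bar k\},\{\bar i,\bar j,k\}$; for each block with $\tau(\{i,j,k\})=1$ include the four blocks $\{\bar i,j,k\},\{\bar i,\bar j,\bar k\},\{i,j,\bar k\},\{i,\bar j,k\}$; finally include the blocks $\{i,\bar i,2n+1\}$ for $i=1,\dots,n$. The result $\bar S$ is an STS of order $N=2n+1$, called an Assmus–Mattson STS. *)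

theory Defs
  imports Main "HOL-Library.FuncSet"
begin

definition steiner_triple_system :: "nat \<Rightarrow> nat set set \<Rightarrow> bool" where
  "steiner_triple_system n S \<longleftrightarrow>
     (\<forall>B\<in>S. B \<subseteq> {1..n} \<and> card B = 3) \<and>
     (\<forall>P. P \<subseteq> {1..n} \<and> card P = 2 \<longrightarrow> (\<exists>!B. B \<in> S \<and> P \<subseteq> B))"

(* The barred copy of a point i is i + n. If all blocks of S have three elements, then i, j, k
   below are distinct and run over all orderings of a block; the two families of four
   blocks are invariant under reordering (an even, respectively odd, number of bars). *)
definition assmus_mattson :: "nat \<Rightarrow> nat set set \<Rightarrow> (nat set \<Rightarrow> nat) \<Rightarrow> nat set set" where
  "assmus_mattson n S \<tau> =
     {T. \<exists>i j k. {i, j, k} \<in> S \<and> \<tau> {i, j, k} = 0 \<and>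
          T \<in> {{i, j, k}, {i, j + n, k + n}, {i + n, j, k + n}, {i + n, j + n, k}}} \<union>
     {T. \<exists>i j k. {i, j, k} \<in> S \<and> \<tau> {i, j, k} = 1 \<and>
          T \<in> {{i + n, j, k}, {i + n, j + n, k + n}, {i, j, k + n}, {i, j + n, k}}} \<union>
     {{i, i + n, 2 * n + 1} | i. i \<in> {1..n}}"

definition assmus_mattson_STS :: "nat \<Rightarrow> nat set set \<Rightarrow> bool" where
  "assmus_mattson_STS N T \<longleftrightarrow>
     (\<exists>n S \<tau>. N = 2 * n + 1 \<and> steiner_triple_system n S \<and> \<tau> \<in> S \<rightarrow> {0, 1} \<and>
        T = assmus_mattson n S \<tau>)"

definition zero_sum_flow :: "int \<Rightarrow> nat \<Rightarrow> nat set set \<Rightarrow> (nat set \<Rightarrow> int) \<Rightarrow> bool" where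
  "zero_sum_flow k N S v \<longleftrightarrow>
     (\<forall>T\<in>S. v T \<noteq> 0 \<and> \<bar>v T\<bar> \<le> k - 1) \<and>
     (\<forall>x\<in>{1..N}. (\<Sum>T | T \<in> S \<and> x \<in> T. v T) = 0)"

end

(* Write a flow on the four lifts T of a block B as v(T) = t(B) + sum of (+/-) g(x, B) over the
   points x of B, the sign being - exactly when x is barred in T. Since the parity of the number of
   bars is fixed, the two lifts of B through a point x (resp. its barred copy) contribute
   2 (t(B) + g(x, B)) (resp. 2 (t(B) - g(x, B))). So v is a zero-sum flow once g is balanced at every
   point and the block {x, x bar, 2n+1} gets -2 sigma(x), where sigma(x), the sum of t over the blocks
   through x, is +-1 or +-2, and t sums to 0.

   For t, fix a point p and a block B0 not through p, and let r be the common degree of the points.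
   Give the blocks through p values +-1, which covers every other point exactly once, and let t(B0)
   compensate their total; t vanishes elsewhere. For g, choose balanced signs +-1 at every point
   other than p on the blocks not through p if r is odd, and on all blocks if r is even. On B0 the
   signs are prescribed to be (-1)^tau(B0), so that the lifts of B0 get t(B0) + 3 and t(B0) - 1. *)

theory Submission
  imports Defs
begin

section \<open>Lifts of blocks and the shape of the flow\<close>

text \<open>Forgets the bar. The extra point \<open>2 * n + 1\<close> is sent to
  \<open>n + 1\<close>, which lies in no block of the base system.\<close>

definition proj :: "nat \<Rightarrow> nat \<Rightarrow> nat" where
  "proj n x = (if x \<le> n then x else x - n)"

text \<open>\<open>c\<close> is the parity of the number of bars. All orderings of \<open>B\<close>
  are allowed, as in \<open>assmus_mattson\<close>, so that splitting the latter by base blocks is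
  pure logic.\<close>

definition lifts :: "nat \<Rightarrow> nat \<Rightarrow> nat set \<Rightarrow> nat set set" where
  "lifts n c B = {T. \<exists>i j k. B = {i, j, k} \<and>
     (c = 0 \<and> T \<in> {{i, j, k}, {i, j + n, k + n}, {i + n, j, k + n}, {i + n, j + n, k}} \<or>
      c = 1 \<and> T \<in> {{i + n, j, k}, {i + n, j + n, k + n}, {i, j, k + n}, {i, j + n, k}})}"

definition fibre_blocks :: "nat \<Rightarrow> nat set set" where
  "fibre_blocks n = (\<lambda>i. {i, i + n, 2 * n + 1}) ` {1..n}"

text \<open>The value must be read off from \<open>T\<close> alone: \<open>2 * n + 1\<close> marks a
  fibre block, whose base point is its least element, while a lift reveals its base block as its
  image under \<open>proj n\<close>.\<close>

definition lift_flow ::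
  "nat \<Rightarrow> nat set set \<Rightarrow> (nat set \<Rightarrow> int) \<Rightarrow> (nat \<Rightarrow> nat set \<Rightarrow> int) \<Rightarrow> nat set \<Rightarrow> int" where
  "lift_flow n S t g T =
     (if 2 * n + 1 \<in> T then - 2 * (\<Sum>B | B \<in> S \<and> Min T \<in> B. t B)
      else t (proj n ` T) +
        (\<Sum>x\<in>T. (if x \<le> n then 1 else - 1) * g (proj n x) (proj n ` T)))"

lemma assmus_mattson_eq: "assmus_mattson n S \<tau> = (\<Union>B\<in>S. lifts n (\<tau> B) B) \<union> fibre_blocks n"
proof -
  \<comment> \<open>Abstract families \<open>X\<close> and \<open>Y\<close> hide the explicit lists
    of lifts from the automation.\<close>
  have *: "{T. \<exists>i j k. {i, j, k} \<in> S \<and> \<tau> {i, j, k} = 0 \<and> T \<in> X i j k} \<union>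
      {T. \<exists>i j k. {i, j, k} \<in> S \<and> \<tau> {i, j, k} = 1 \<and> T \<in> Y i j k} =
      (\<Union>B\<in>S. {T. \<exists>i j k. B = {i, j, k} \<and> (\<tau> B = 0 \<and> T \<in> X i j k \<or> \<tau> B = 1 \<and> T \<in> Y i j k)})"
    for X Y :: "nat \<Rightarrow> nat \<Rightarrow> nat \<Rightarrow> nat set set"
    by blast
  have "{{i, i + n, 2 * n + 1} | i. i \<in> {1..n}} = fibre_blocks n"
    unfolding fibre_blocks_def by (rule Setcompr_eq_image)
  then show ?thesis unfolding assmus_mattson_def lifts_def * by (rule arg_cong)
qed

text \<open>Equality with a set of three elements forces \<open>i\<close>, \<open>j\<close>,
  \<open>k\<close> to be distinct, hence one of six permutations. This removes the arbitrary
  ordering hidden in \<open>lifts\<close>.\<close>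

lemma triple_eq_cases:
  assumes "{i, j, k} = {a, b, c}" "a \<noteq> b" "a \<noteq> c" "b \<noteq> c"
  obtains "i = a" "j = b" "k = c" | "i = a" "j = c" "k = b" | "i = b" "j = a" "k = c"
    | "i = b" "j = c" "k = a" | "i = c" "j = a" "k = b" | "i = c" "j = b" "k = a"
proof -
  have m: "i \<in> {a, b, c}" "j \<in> {a, b, c}" "k \<in> {a, b, c}" using assms(1) by blast+
  have "card {i, j, k} = 3" using assms by simp
  then have "i \<noteq> j" "i \<noteq> k" "j \<noteq> k" by (auto simp: card_insert_if split: if_splits)
  with m that show thesis by auto
qed

text \<open>Permuting the block only permutes the four ways of placing an even number of bars, so
  one ordering already gives all lifts.\<close>

lemma lifts_even:
  assumes "a \<noteq> b" "a \<noteq> c" "b \<noteq> c"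
  shows "lifts n 0 {a, b, c} = {{a, b, c}, {a, b + n, c + n}, {a + n, b, c + n}, {a + n, b + n, c}}"
    (is "_ = ?R")
proof
  show "lifts n 0 {a, b, c} \<subseteq> ?R"
  proof
    fix T assume "T \<in> lifts n 0 {a, b, c}"
    then have "\<exists>i j k. {a, b, c} = {i, j, k} \<and> T \<in> {{i, j, k}, {i, j + n, k + n}, {i + n, j, k + n}, {i + n, j + n, k}}"
      by (simp only: lifts_def mem_Collect_eq zero_neq_one one_neq_zero simp_thms)
    then obtain i j k where e: "{i, j, k} = {a, b, c}" and T: "T \<in> {{i, j, k}, {i, j + n, k + n}, {i + n, j, k + n}, {i + n, j + n, k}}"
      by (elim exE conjE) (rule that, simp only:)
    show "T \<in> ?R"
      by (rule triple_eq_cases[OF e assms]) (use T in \<open>auto simp: insert_commute\<close>)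
  qed
  show "?R \<subseteq> lifts n 0 {a, b, c}"
    unfolding lifts_def by (intro subsetI CollectI exI[of _ a] exI[of _ b] exI[of _ c]) simp
qed

lemma lifts_odd:
  assumes "a \<noteq> b" "a \<noteq> c" "b \<noteq> c"
  shows "lifts n 1 {a, b, c} =
    {{a + n, b, c}, {a + n, b + n, c + n}, {a, b, c + n}, {a, b + n, c}}"
    (is "_ = ?R")
proof
  show "lifts n 1 {a, b, c} \<subseteq> ?R"
  proof
    fix T assume "T \<in> lifts n 1 {a, b, c}"
    then have "\<exists>i j k. {a, b, c} = {i, j, k} \<and> T \<in> {{i + n, j, k}, {i + n, j + n, k + n}, {i, j, k + n}, {i, j + n, k}}"
      by (simp only: lifts_def mem_Collect_eq zero_neq_one one_neq_zero simp_thms)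
    then obtain i j k where e: "{i, j, k} = {a, b, c}" and T: "T \<in> {{i + n, j, k}, {i + n, j + n, k + n}, {i, j, k + n}, {i, j + n, k}}"
      by (elim exE conjE) (rule that, simp only:)
    show "T \<in> ?R"
      by (rule triple_eq_cases[OF e assms]) (use T in \<open>auto simp: insert_commute\<close>)
  qed
  show "?R \<subseteq> lifts n 1 {a, b, c}"
    unfolding lifts_def by (intro subsetI CollectI exI[of _ a] exI[of _ b] exI[of _ c]) simp
qed

section \<open>Values of the flow and its sums at a point\<close>

lemma lift_flow_lift:
  assumes "a \<noteq> b" "a \<noteq> c" "b \<noteq> c" "{a, b, c} \<subseteq> {1..n}"
    and "x \<in> {a, a + n}" "y \<in> {b, b + n}" "z \<in> {c, c + n}"
  shows "lift_flow n S t g {x, y, z} = t {a, b, c} + (if x = a then 1 else - 1) * g a {a, b, c}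
    + (if y = b then 1 else - 1) * g b {a, b, c} + (if z = c then 1 else - 1) * g c {a, b, c}"
proof -
  have pr: "proj n x = a" "proj n y = b" "proj n z = c"
    using assms by (auto simp: proj_def)
  have im: "proj n ` {x, y, z} = {a, b, c}" by (simp add: pr)
  \<comment> \<open>Different projections keep the three points apart, so the sum over the set
    really has three terms.\<close>
  have ne: "x \<noteq> y" "x \<noteq> z" "y \<noteq> z" using pr assms by auto
  have le: "(x \<le> n) = (x = a)" "(y \<le> n) = (y = b)" "(z \<le> n) = (z = c)"
    using assms by auto
  have "2 * n + 1 \<notin> {x, y, z}" using assms by auto
  then show ?thesis unfolding lift_flow_def im
    using ne by (simp add: pr le)
qed

text \<open>Lets the simplifier pick out the lifts through a point, one listed lift at a
  time.\<close>

lemma filter_insert: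
  "{T. (T = A \<or> P T) \<and> x \<in> T} =
    (if x \<in> A then insert A {T. P T \<and> x \<in> T} else {T. P T \<and> x \<in> T})"
  "{T. T = A \<and> x \<in> T} = (if x \<in> A then {A} else {})"
  by auto

text \<open>Exactly two lifts pass through the point, and they differ in the bars of both remaining
  points. The \<open>g\<close> terms of those two points therefore cancel.\<close>

lemma sum_lifts_eq:
  assumes "card B = 3" "B \<subseteq> {1..n}" "c \<in> {0, 1}" "i \<in> B"
  shows "(\<Sum>T | T \<in> lifts n c B \<and> i \<in> T. lift_flow n S t g T) = 2 * (t B + g i B)"
    and "(\<Sum>T | T \<in> lifts n c B \<and> i + n \<in> T. lift_flow n S t g T) = 2 * (t B - g i B)"
proof -
  obtain j k where B: "B = {i, j, k}" and ne: "i \<noteq> j" "i \<noteq> k" "j \<noteq> k"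
  proof -
    have "card (B - {i}) = 2" using assms by simp
    then obtain j k where "B - {i} = {j, k}" "j \<noteq> k" by (auto simp: card_2_iff)
    with assms(4) that[of j k] show ?thesis by blast
  qed
  note r = assms(2)[unfolded B]
  note L = lift_flow_lift[OF ne r]
  have d: "i \<in> {1..n}" "j \<in> {1..n}" "k \<in> {1..n}" using r by auto
  have nm: "n > 0" "i \<noteq> i + n" "i \<noteq> j + n" "i \<noteq> k + n" "j \<noteq> i + n" "j \<noteq> j + n" "j \<noteq> k + n"
    "k \<noteq> i + n" "k \<noteq> j + n" "k \<noteq> k + n"
    using d by auto
  note nm' = nm(2-)[symmetric]
  have "{T. T \<in> lifts n c B \<and> i \<in> T} =
      (if c = 0 then {{i, j, k}, {i, j + n, k + n}} else {{i, j, k + n}, {i, j + n, k}})"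
    using assms(3) unfolding B
    by (elim insertE) (simp_all add: lifts_even[OF ne] lifts_odd[OF ne, simplified] filter_insert ne nm nm')
  moreover have "{i, j, k} \<noteq> {i, j + n, k + n}" "{i, j, k + n} \<noteq> {i, j + n, k}"
    using ne nm by auto
  ultimately show "(\<Sum>T | T \<in> lifts n c B \<and> i \<in> T. lift_flow n S t g T) = 2 * (t B + g i B)"
    using L d by (simp add: B)
  have "{T. T \<in> lifts n c B \<and> i + n \<in> T} =
      (if c = 0 then {{i + n, j, k + n}, {i + n, j + n, k}} else {{i + n, j, k}, {i + n, j + n, k + n}})"
    using assms(3) unfolding B
    by (elim insertE) (simp_all add: lifts_even[OF ne] lifts_odd[OF ne, simplified] filter_insert ne nm nm')
  moreover have "{i + n, j, k + n} \<noteq> {i + n, j + n, k}" "{i + n, j, k} \<noteq> {i + n, j + n, k + n}"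
    using ne nm by auto
  ultimately show "(\<Sum>T | T \<in> lifts n c B \<and> i + n \<in> T. lift_flow n S t g T) = 2 * (t B - g i B)"
    using L d by (simp add: B)
qed

text \<open>A lift determines its base block, so different blocks have disjoint families of lifts;
  and it avoids \<open>2 * n + 1\<close>, so it is no fibre block.\<close>

lemma lifts_proj:
  assumes "card B = 3" "B \<subseteq> {1..n}" "T \<in> lifts n c B"
  shows "proj n ` T = B" "T \<subseteq> {1..2 * n}" "finite T"
proof -
  obtain i j k where B: "B = {i, j, k}"
    and "c = 0 \<and> T \<in> {{i, j, k}, {i, j + n, k + n}, {i + n, j, k + n}, {i + n, j + n, k}} \<or>
      c = 1 \<and> T \<in> {{i + n, j, k}, {i + n, j + n, k + n}, {i, j, k + n}, {i, j + n, k}}"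
    using assms(3) unfolding lifts_def mem_Collect_eq by (elim exE conjE) (rule that)
  then have T: "T \<in> {{i, j, k}, {i, j + n, k + n}, {i + n, j, k + n}, {i + n, j + n, k},
      {i + n, j, k}, {i + n, j + n, k + n}, {i, j, k + n}, {i, j + n, k}}"
    by (elim disjE conjE insertE emptyE) simp_all
  have d: "i \<in> {1..n}" "j \<in> {1..n}" "k \<in> {1..n}" using assms(2) B by auto
  then have p: "proj n i = i" "proj n j = j" "proj n k = k"
    "proj n (i + n) = i" "proj n (j + n) = j" "proj n (k + n) = k"
    by (auto simp: proj_def)
  show "proj n ` T = B" using T p unfolding B by auto
  show sub: "T \<subseteq> {1..2 * n}" using T d by auto
  then show "finite T" by (rule finite_subset) simp
qed

lemma sum_lifts_notin:
  assumes "card B = 3" "B \<subseteq> {1..n}" "proj n x \<notin> B"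
  shows "(\<Sum>T | T \<in> lifts n c B \<and> x \<in> T. f T) = (0 :: int)"
proof -
  have "{T. T \<in> lifts n c B \<and> x \<in> T} = {}"
    using lifts_proj(1)[OF assms(1,2)] assms(3) by blast
  then show ?thesis by (simp only: sum.empty)
qed

lemma lift_flow_fibre:
  "i \<in> {1..n} \<Longrightarrow> lift_flow n S t g {i, i + n, 2 * n + 1} = - 2 * (\<Sum>B | B \<in> S \<and> i \<in> B. t B)"
proof -
  assume "i \<in> {1..n}"
  then have "Min {i, i + n, 2 * n + 1} = i" by (intro Min_eqI) auto
  then show ?thesis by (simp add: lift_flow_def del: Min_insert)
qed

lemma inj_on_fibre: "inj_on (\<lambda>i. {i, i + n, 2 * n + 1}) {1..n :: nat}"
proof (rule inj_onI)
  fix i j :: nat assume ij: "i \<in> {1..n}" "j \<in> {1..n}" "{i, i + n, 2 * n + 1} = {j, j + n, 2 * n + 1}"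
  then have "i \<in> {j, j + n, 2 * n + 1}" by blast
  with ij(1,2) show "i = j" by auto
qed

lemma finite_lifts:
  assumes "card B = 3" "B \<subseteq> {1..n}"
  shows "finite (lifts n c B)"
  by (rule finite_subset[of _ "Pow {1..2 * n}"]) (use lifts_proj(2)[OF assms] in auto)

section \<open>Reduction to a labelling of the base system\<close>

lemma sum_assmus_mattson:
  fixes f :: "nat set \<Rightarrow> int"
  assumes blocks: "\<And>B. B \<in> S \<Longrightarrow> B \<subseteq> {1..n} \<and> card B = 3"
  shows "(\<Sum>T | T \<in> assmus_mattson n S \<tau> \<and> x \<in> T. f T) =
    (\<Sum>B\<in>S. \<Sum>T | T \<in> lifts n (\<tau> B) B \<and> x \<in> T. f T) + (\<Sum>T | T \<in> fibre_blocks n \<and> x \<in> T. f T)"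
proof -
  have finS: "finite S"
    by (rule finite_subset[of _ "Pow {1..n}"]) (use blocks in auto)
  have "{T. T \<in> assmus_mattson n S \<tau> \<and> x \<in> T} =
      (\<Union>B\<in>S. {T. T \<in> lifts n (\<tau> B) B \<and> x \<in> T}) \<union> {T. T \<in> fibre_blocks n \<and> x \<in> T}"
    (is "_ = ?A \<union> ?F") unfolding assmus_mattson_eq by auto
  \<comment> \<open>The point \<open>2 * n + 1\<close> separates the two families.\<close>
  moreover have "?A \<inter> ?F = {}"
  proof -
    have "2 * n + 1 \<notin> T" if "T \<in> ?A" for T
    proof -
      from that obtain B where "B \<in> S" "T \<in> lifts n (\<tau> B) B" by blast
      then have "T \<subseteq> {1..2 * n}" using lifts_proj(2) blocks by blast
      then show ?thesis by auto
    qed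
    moreover have "2 * n + 1 \<in> T" if "T \<in> ?F" for T
      using that unfolding fibre_blocks_def by auto
    ultimately show ?thesis by blast
  qed
  moreover have fA: "finite {T. T \<in> lifts n (\<tau> B) B \<and> x \<in> T}" if "B \<in> S" for B
    using finite_lifts blocks[OF that] by simp
  moreover have "finite ?A" using finS fA by blast
  moreover have "finite ?F" unfolding fibre_blocks_def by simp
  moreover have "sum f ?A = (\<Sum>B\<in>S. \<Sum>T | T \<in> lifts n (\<tau> B) B \<and> x \<in> T. f T)"
  proof (rule sum.UNION_disjoint[OF finS])
    show "\<forall>B\<in>S. finite {T. T \<in> lifts n (\<tau> B) B \<and> x \<in> T}" using fA by blast
    show "\<forall>B\<in>S. \<forall>C\<in>S. B \<noteq> C \<longrightarrow>
        {T. T \<in> lifts n (\<tau> B) B \<and> x \<in> T} \<inter> {T. T \<in> lifts n (\<tau> C) C \<and> x \<in> T} = {}"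
    proof (intro ballI impI equals0I)
      fix B C T assume BC: "B \<in> S" "C \<in> S" "B \<noteq> C"
        and "T \<in> {T. T \<in> lifts n (\<tau> B) B \<and> x \<in> T} \<inter> {T. T \<in> lifts n (\<tau> C) C \<and> x \<in> T}"
      then have T: "T \<in> lifts n (\<tau> B) B" "T \<in> lifts n (\<tau> C) C" by simp_all
      have "proj n ` T = B" "proj n ` T = C"
        using lifts_proj(1)[OF _ _ T(1)] lifts_proj(1)[OF _ _ T(2)] blocks BC(1,2) by simp_all
      with BC(3) show False by simp
    qed
  qed
  ultimately show ?thesis by (simp only: sum.union_disjoint)
qed

text \<open>Double counting of incidences: each block is counted at its three points. With total 0
  this gives balance at \<open>2 * n + 1\<close>.\<close>

lemma sum_point_sums:
  fixes t :: "nat set \<Rightarrow> int"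
  assumes blocks: "\<And>B. B \<in> S \<Longrightarrow> B \<subseteq> {1..n} \<and> card B = 3"
  shows "(\<Sum>i\<in>{1..n}. \<Sum>B | B \<in> S \<and> i \<in> B. t B) = 3 * (\<Sum>B\<in>S. t B)"
proof -
  have finS: "finite S"
    by (rule finite_subset[of _ "Pow {1..n}"]) (use blocks in auto)
  have "(\<Sum>i\<in>{1..n}. \<Sum>B | B \<in> S \<and> i \<in> B. t B) = (\<Sum>B\<in>S. \<Sum>i | i \<in> {1..n} \<and> i \<in> B. t B)"
    by (rule sum.swap_restrict) (use finS in auto)
  also have "\<dots> = (\<Sum>B\<in>S. 3 * t B)"
  proof (rule sum.cong[OF refl])
    fix B assume "B \<in> S"
    then have "{i. i \<in> {1..n} \<and> i \<in> B} = B" "card B = 3" using blocks by blast+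
    then show "(\<Sum>i | i \<in> {1..n} \<and> i \<in> B. t B) = 3 * t B" by (simp only: sum_constant)
  qed
  finally show ?thesis by (simp add: sum_distrib_left)
qed

text \<open>The sign triples in \<open>val\<close> with product
  \<open>(- 1) ^ \<tau> {i, j, k}\<close> are the bar patterns of the lifts, and \<open>pt\<close>
  puts the fibre values into \<plusminus>2, \<plusminus>4. At a point over \<open>i\<close> the
  lifts contribute twice the sum of \<open>t\<close> through \<open>i\<close>, since
  \<open>g\<close> cancels by \<open>g0\<close>, and the fibre block removes it.\<close>

lemma zero_sum_flow_lift_flow:
  fixes \<tau> :: "nat set \<Rightarrow> nat"
  assumes blocks: "\<And>B. B \<in> S \<Longrightarrow> B \<subseteq> {1..n} \<and> card B = 3"
    and tau: "\<tau> \<in> S \<rightarrow> {0, 1}"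
    and g0: "\<And>i. i \<in> {1..n} \<Longrightarrow> (\<Sum>B | B \<in> S \<and> i \<in> B. g i B) = 0"
    and pt: "\<And>i. i \<in> {1..n} \<Longrightarrow>
      (\<Sum>B | B \<in> S \<and> i \<in> B. t B) \<noteq> 0 \<and> \<bar>\<Sum>B | B \<in> S \<and> i \<in> B. t B\<bar> \<le> 2"
    and t0: "(\<Sum>B\<in>S. t B) = 0"
    and val: "\<And>i j k x y z. \<lbrakk>{i, j, k} \<in> S; i \<noteq> j; i \<noteq> k; j \<noteq> k;
        x \<in> {1, - 1}; y \<in> {1, - 1}; z \<in> {1, - 1}; x * y * z = (- 1) ^ \<tau> {i, j, k}\<rbrakk> \<Longrightarrow>
        t {i, j, k} + x * g i {i, j, k} + y * g j {i, j, k} + z * g k {i, j, k} \<noteq> 0 \<and>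
        \<bar>t {i, j, k} + x * g i {i, j, k} + y * g j {i, j, k} + z * g k {i, j, k}\<bar> \<le> 4"
  shows "zero_sum_flow 5 (2 * n + 1) (assmus_mattson n S \<tau>) (lift_flow n S t g)"
proof -
  let ?v = "lift_flow n S t g"
  have finS: "finite S"
    by (rule finite_subset[of _ "Pow {1..n}"]) (use blocks in auto)
  have bound: "?v T \<noteq> 0 \<and> \<bar>?v T\<bar> \<le> 4" if T: "T \<in> assmus_mattson n S \<tau>" for T
  proof (cases "T \<in> fibre_blocks n")
    case True
    then obtain i where "i \<in> {1..n}" "T = {i, i + n, 2 * n + 1}"
      unfolding fibre_blocks_def by blast
    with lift_flow_fibre[of i n S t g] pt[of i] show ?thesis by auto
  next
    case False
    with T obtain B where B: "B \<in> S" "T \<in> lifts n (\<tau> B) B"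
      unfolding assmus_mattson_eq by blast
    then obtain i j k where Bijk: "B = {i, j, k}" and ne: "i \<noteq> j" "i \<noteq> k" "j \<noteq> k"
      using blocks[of B] by (auto simp: card_3_iff)
    have S: "{i, j, k} \<in> S" and sub: "{i, j, k} \<subseteq> {1..n}" using B blocks[OF B(1)] Bijk by simp_all
    have d: "i \<noteq> i + n" "j \<noteq> j + n" "k \<noteq> k + n" using sub by auto
    note L = lift_flow_lift[OF ne sub]
    note V = val[OF S ne]
    have "\<tau> B \<in> {0, 1}" by (rule funcset_mem[OF tau B(1)])
    then have "\<tau> B = 0 \<or> \<tau> B = 1" by simp
    then show ?thesis
    proof
      assume 1: "\<tau> B = 0"
      then have "T \<in> {{i, j, k}, {i, j + n, k + n}, {i + n, j, k + n}, {i + n, j + n, k}}"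
        using B(2) lifts_even[OF ne] Bijk by auto
      then show ?thesis
        \<comment> \<open>The four sign triples with product 1, one for each lift with an even
          number of bars.\<close>
        using 1 d L V[of 1 1 1] V[of 1 "-1" "-1"] V[of "-1" 1 "-1"] V[of "-1" "-1" 1]
        unfolding Bijk by auto
    next
      assume 2: "\<tau> B = 1"
      then have "T \<in> {{i + n, j, k}, {i + n, j + n, k + n}, {i, j, k + n}, {i, j + n, k}}"
        using B(2) lifts_odd[OF ne] Bijk by auto
      then show ?thesis
        \<comment> \<open>Likewise the four triples with product -1, for an odd number of
          bars.\<close>
        using 2 d L V[of "-1" 1 1] V[of "-1" "-1" "-1"] V[of 1 1 "-1"] V[of 1 "-1" 1]
        unfolding Bijk by auto
    qed
  qed
  have fib: "(\<Sum>T | T \<in> fibre_blocks n \<and> x \<in> T. ?v T) = - 2 * (\<Sum>B | B \<in> S \<and> i \<in> B. t B)"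
    if i: "i \<in> {1..n}" and x: "x \<in> {i, i + n}" for i x
  proof -
    have "{T. T \<in> fibre_blocks n \<and> x \<in> T} = {{i, i + n, 2 * n + 1}}"
      using i x unfolding fibre_blocks_def by auto
    then show ?thesis using lift_flow_fibre[OF i, of S t g] by (simp only: sum.insert sum.empty finite.emptyI) simp
  qed
  have "(\<Sum>T | T \<in> assmus_mattson n S \<tau> \<and> x \<in> T. ?v T) = 0" if x: "x \<in> {1..2 * n + 1}" for x
  proof (cases "x = 2 * n + 1")
    case True
    have "(\<Sum>T | T \<in> lifts n (\<tau> B) B \<and> x \<in> T. ?v T) = 0" if "B \<in> S" for B
    proof -
      have "proj n x \<notin> B" using True blocks[OF that] by (auto simp: proj_def)
      then show ?thesis using sum_lifts_notin blocks[OF that] by blast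
    qed
    moreover have "(\<Sum>T | T \<in> fibre_blocks n \<and> x \<in> T. ?v T) = 0"
    proof -
      have "{T. T \<in> fibre_blocks n \<and> x \<in> T} = (\<lambda>i. {i, i + n, 2 * n + 1}) ` {1..n}"
        unfolding fibre_blocks_def True by auto
      then have "(\<Sum>T | T \<in> fibre_blocks n \<and> x \<in> T. ?v T) =
          (\<Sum>i\<in>{1..n}. ?v {i, i + n, 2 * n + 1})"
        by (simp only: sum.reindex[OF inj_on_fibre] comp_def)
      also have "\<dots> = (\<Sum>i\<in>{1..n}. - 2 * (\<Sum>B | B \<in> S \<and> i \<in> B. t B))"
        by (rule sum.cong[OF refl]) (rule lift_flow_fibre)
      also have "\<dots> = - 2 * (\<Sum>i\<in>{1..n}. \<Sum>B | B \<in> S \<and> i \<in> B. t B)"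
        by (simp only: sum_distrib_left)
      finally show ?thesis using sum_point_sums[of S n t] blocks t0 by simp
    qed
    ultimately show ?thesis using sum_assmus_mattson[of S n ?v \<tau> x] blocks by simp
  next
    case False
    define i where "i = proj n x"
    have i: "i \<in> {1..n}" and xi: "x \<in> {i, i + n}"
      using x False by (auto simp: i_def proj_def)
    \<comment> \<open>The sign \<open>e\<close> treats \<open>i\<close> and its barred copy at
      once.\<close>
    define e :: int where "e = (if x = i then 1 else - 1)"
    have "(\<Sum>B\<in>S. \<Sum>T | T \<in> lifts n (\<tau> B) B \<and> x \<in> T. ?v T) =
        (\<Sum>B\<in>S. if i \<in> B then 2 * (t B + e * g i B) else 0)"
    proof (rule sum.cong[OF refl])
      fix B assume B: "B \<in> S"
      have c: "\<tau> B \<in> {0, 1}" by (rule funcset_mem[OF tau B])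
      show "(\<Sum>T | T \<in> lifts n (\<tau> B) B \<and> x \<in> T. ?v T) =
          (if i \<in> B then 2 * (t B + e * g i B) else 0)"
      proof (cases "i \<in> B")
        case True
        then show ?thesis
          using sum_lifts_eq[OF _ _ c True, of n S t g] blocks[OF B] xi
          by (cases "x = i") (auto simp: e_def)
      next
        case False
        then show ?thesis using sum_lifts_notin[of B n x] blocks[OF B] i_def by auto
      qed
    qed
    also have "\<dots> = (\<Sum>B | B \<in> S \<and> i \<in> B. 2 * (t B + e * g i B))"
      by (rule sum.inter_filter[OF finS, symmetric])
    also have "\<dots> = 2 * (\<Sum>B | B \<in> S \<and> i \<in> B. t B) + 2 * e * (\<Sum>B | B \<in> S \<and> i \<in> B. g i B)"
      by (simp add: sum.distrib sum_distrib_left algebra_simps)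
    finally show ?thesis
      using sum_assmus_mattson[of S n ?v \<tau> x] blocks fib[OF i xi] g0[OF i] by simp
  qed
  with bound show ?thesis unfolding zero_sum_flow_def by simp
qed

section \<open>Balanced signs on a set of even size\<close>

text \<open>Give one half of \<open>F\<close> the sign 1 and the rest -1; negating all signs keeps
  the sum 0 and adjusts the value at \<open>x0\<close>.\<close>

lemma balanced_signs:
  assumes "finite F" "even (card F)" "d = 1 \<or> d = (- 1 :: int)"
  shows "\<exists>e. (\<forall>x. e x = 1 \<or> e x = - 1) \<and> sum e F = 0 \<and> e x0 = d"
proof -
  obtain H where H: "H \<subseteq> F" "card H = card F div 2"
    using obtain_subset_with_card_n[of "card F div 2" F] by auto
  define h :: "'a \<Rightarrow> int" where "h x = (if x \<in> H then 1 else - 1)" for x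
  have fH: "finite H" using H assms finite_subset by blast
  have "sum h F = sum h H + sum h (F - H)"
    using H assms by (metis add.commute sum.subset_diff)
  also have "sum h H = int (card H)" by (simp add: h_def)
  also have "sum h (F - H) = (\<Sum>x\<in>F - H. - 1)" by (rule sum.cong) (auto simp: h_def)
  also have "\<dots> = - int (card F - card H)" using H fH by (simp add: card_Diff_subset)
  finally have s: "sum h F = 0" using H assms(2) by auto
  show ?thesis
  proof (cases "h x0 = d")
    case True
    then show ?thesis using s by (intro exI[of _ h]) (auto simp: h_def)
  next
    case False
    then have "- h x0 = d" using assms(3) by (auto simp: h_def split: if_splits)
    then show ?thesis using s by (intro exI[of _ "\<lambda>x. - h x"]) (auto simp: h_def sum_negf)
  qed
qed

section \<open>Elementary facts on Steiner triple systems\<close>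

lemma STS_block_exists:
  assumes S: "steiner_triple_system n S" and "x \<in> {1..n}" "y \<in> {1..n}" "x \<noteq> y"
  obtains B where "B \<in> S" "x \<in> B" "y \<in> B"
proof -
  have "card {x, y} = 2" "{x, y} \<subseteq> {1..n}" using assms by auto
  then have "\<exists>!B. B \<in> S \<and> {x, y} \<subseteq> B"
    using conjunct2[OF S[unfolded steiner_triple_system_def], THEN spec, of "{x, y}"] by simp
  then show thesis using that by auto
qed

lemma STS_block_unique:
  assumes S: "steiner_triple_system n S" and B: "B \<in> S" "x \<in> B" "y \<in> B"
    and C: "C \<in> S" "x \<in> C" "y \<in> C" and "x \<noteq> y"
  shows "B = C"
proof -
  have "B \<subseteq> {1..n}" using S B unfolding steiner_triple_system_def by blast
  then have "card {x, y} = 2" "{x, y} \<subseteq> {1..n}" using assms by auto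
  then have ex: "\<exists>!B. B \<in> S \<and> {x, y} \<subseteq> B"
    using conjunct2[OF S[unfolded steiner_triple_system_def], THEN spec, of "{x, y}"] by simp
  show ?thesis using ex B C by (metis empty_subsetI insert_subset)
qed

text \<open>The blocks through \<open>x\<close>, with \<open>x\<close> removed, partition the other
  points into pairs. In particular all points have the same degree.\<close>

lemma STS_degree:
  assumes S: "steiner_triple_system n S" and x: "x \<in> {1..n}"
  shows "2 * card {B \<in> S. x \<in> B} = n - 1"
proof -
  have bl: "B \<subseteq> {1..n} \<and> card B = 3" if "B \<in> S" for B
    using S that unfolding steiner_triple_system_def by blast
  have finS: "finite S"
    by (rule finite_subset[of _ "Pow {1..n}"]) (use bl in auto)
  have "(\<Union>B\<in>{B \<in> S. x \<in> B}. B - {x}) = {1..n} - {x}"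
  proof
    show "(\<Union>B\<in>{B \<in> S. x \<in> B}. B - {x}) \<subseteq> {1..n} - {x}" using bl by blast
    show "{1..n} - {x} \<subseteq> (\<Union>B\<in>{B \<in> S. x \<in> B}. B - {x})"
    proof
      fix y assume y: "y \<in> {1..n} - {x}"
      then obtain B where "B \<in> S" "x \<in> B" "y \<in> B" using STS_block_exists[OF S x, of y] by auto
      with y show "y \<in> (\<Union>B\<in>{B \<in> S. x \<in> B}. B - {x})" by blast
    qed
  qed
  moreover have "card (\<Union>B\<in>{B \<in> S. x \<in> B}. B - {x}) = (\<Sum>B\<in>{B \<in> S. x \<in> B}. card (B - {x}))"
  proof (rule card_UN_disjoint)
    show "finite {B \<in> S. x \<in> B}" using finS by simp
    show "\<forall>B\<in>{B \<in> S. x \<in> B}. finite (B - {x})" using bl finite_subset by blast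
    show "\<forall>B\<in>{B \<in> S. x \<in> B}. \<forall>C\<in>{B \<in> S. x \<in> B}. B \<noteq> C \<longrightarrow> (B - {x}) \<inter> (C - {x}) = {}"
      using STS_block_unique[OF S] by blast
  qed
  moreover have "(\<Sum>B\<in>{B \<in> S. x \<in> B}. card (B - {x})) = (\<Sum>B\<in>{B \<in> S. x \<in> B}. 2)"
    by (rule sum.cong[OF refl]) (use bl in auto)
  ultimately show ?thesis using x by simp
qed

text \<open>Take the block through 1 and 2 and a point \<open>x\<close> outside it. The block
  through 2 and \<open>x\<close> cannot contain 1, as it would then be the first block.\<close>

lemma STS_block_avoiding_1:
  assumes S: "steiner_triple_system n S" and n: "n \<ge> 4"
  obtains B where "B \<in> S" "1 \<notin> B"
proof -
  have r: "1 \<in> {1..n}" "2 \<in> {1..n}" using n by auto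
  obtain C where C: "C \<in> S" "1 \<in> C" "2 \<in> C"
    using STS_block_exists[OF S r] by auto
  then have "card C = 3" using S unfolding steiner_triple_system_def by blast
  then have "\<not> {1..n} \<subseteq> C" using n card_mono[of C "{1..n}"] card.infinite[of C] by fastforce
  then obtain x where x: "x \<in> {1..n}" "x \<notin> C" by blast
  then have "2 \<noteq> x" using C by auto
  then obtain B where B: "B \<in> S" "2 \<in> B" "x \<in> B"
    using STS_block_exists[OF S r(2) x(1)] by auto
  have "1 \<notin> B"
    using STS_block_unique[OF S, of B 1 2 C] B C x by auto
  with B that show ?thesis by blast
qed

section \<open>The block labelling \<open>t\<close>\<close>

text \<open>A point off \<open>B0\<close> other than \<open>p\<close> sees only its one block
  through \<open>p\<close>, so its sum is \<plusminus>1. The blocks through \<open>p\<close> that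
  meet \<open>B0\<close> all get \<open>d\<close>, so points of \<open>B0\<close> have sum
  \<open>d + t0\<close>, which is -1 or -2. At \<open>p\<close> the sum is
  \<open>- t0\<close>.\<close>

lemma STS_labelling:
  fixes d t0 :: int
  assumes S: "steiner_triple_system n S" and n: "n \<ge> 15"
    and p: "p \<in> {1..n}" and B0: "B0 \<in> S" "p \<notin> B0"
    and dt: "(d, t0) = (if even (card {B \<in> S. p \<in> B}) then (1, - 2) else (- 1, - 1))"
  obtains t :: "nat set \<Rightarrow> int" where
    "\<And>B. B \<in> S \<Longrightarrow> p \<in> B \<Longrightarrow> t B = 1 \<or> t B = - 1"
    "t B0 = t0"
    "\<And>B. p \<notin> B \<Longrightarrow> B \<noteq> B0 \<Longrightarrow> t B = 0"
    "(\<Sum>B\<in>S. t B) = 0"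
    "\<And>i. i \<in> {1..n} \<Longrightarrow>
      (\<Sum>B | B \<in> S \<and> i \<in> B. t B) \<noteq> 0 \<and> \<bar>\<Sum>B | B \<in> S \<and> i \<in> B. t B\<bar> \<le> 2"
proof -
  have bl: "B \<subseteq> {1..n} \<and> card B = 3" if "B \<in> S" for B
    using S that unfolding steiner_triple_system_def by blast
  have finS: "finite S"
    by (rule finite_subset[of _ "Pow {1..n}"]) (use bl in auto)
  define st where "st = {B \<in> S. p \<in> B}"
  define r where "r = card st"
  have fst: "finite st" using finS by (simp add: st_def)
  have r7: "r \<ge> 7" using STS_degree[OF S p] n by (simp add: r_def st_def)
  define A where "A = {B \<in> st. B \<inter> B0 \<noteq> {}}"
  \<comment> \<open>The number of blocks through \<open>p\<close> labelled \<open>d\<close>, solving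
    \<open>d * (2 * m - r) = - t0\<close>.\<close>
  define m where "m = (if even r then (r + 2) div 2 else (r - 1) div 2)"
  have "card A \<le> 3"
  proof -
    have fB0: "finite B0" "card B0 = 3" using bl[OF B0(1)] finite_subset by auto
    \<comment> \<open>A block through \<open>p\<close> that meets \<open>B0\<close> is determined by
      a common point, since \<open>p\<close> is not in \<open>B0\<close>.\<close>
    have "A \<subseteq> (\<lambda>x. THE B. B \<in> S \<and> p \<in> B \<and> x \<in> B) ` B0"
    proof
      fix B assume "B \<in> A"
      then obtain x where x: "B \<in> S" "p \<in> B" "x \<in> B" "x \<in> B0" by (auto simp: A_def st_def)
      then have "p \<noteq> x" using B0 by auto
      then have "(THE B. B \<in> S \<and> p \<in> B \<and> x \<in> B) = B"
        using x STS_block_unique[OF S] by (intro the_equality) blast+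
      with x show "B \<in> (\<lambda>x. THE B. B \<in> S \<and> p \<in> B \<and> x \<in> B) ` B0" by blast
    qed
    then show ?thesis using fB0 by (metis surj_card_le)
  qed
  \<comment> \<open>Degree at least 7, from \<open>n \<ge> 15\<close>, leaves room in
    \<open>M\<close> for the at most three blocks of \<open>A\<close>; degree 7 gives exactly
    \<open>m = 3\<close>.\<close>
  moreover have "3 \<le> m" "m \<le> r" using r7 unfolding m_def by (auto elim!: evenE oddE)
  ultimately obtain M where M: "A \<subseteq> M" "M \<subseteq> st" "card M = m"
    using exists_subset_between[of A m st] fst by (auto simp: A_def r_def)
  define t where
    "t B = (if B \<in> M then d else if p \<in> B then - d else if B = B0 then t0 else 0)" for B
  have star_sum: "sum t st = - t0"
  proof -
    have "sum t st = sum t M + sum t (st - M)"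
      using M fst by (metis add.commute sum.subset_diff)
    also have "sum t M = int m * d" using M by (simp add: t_def)
    also have "sum t (st - M) = (\<Sum>x\<in>st - M. - d)" by (rule sum.cong) (auto simp: t_def st_def)
    also have "\<dots> = - d * int (r - m)"
      using card_Diff_subset[OF finite_subset[OF M(2) fst] M(2)] M(3) by (simp add: r_def)
    finally have "sum t st = d * (2 * int m - int r)"
      using \<open>m \<le> r\<close> by (simp add: algebra_simps of_nat_diff)
    then show ?thesis using dt r7 by (auto simp: m_def r_def st_def elim!: evenE oddE split: if_splits)
  qed
  have tB0: "t B0 = t0" using B0 M by (auto simp: t_def st_def)
  have t1: "t B = 1 \<or> t B = - 1" if "B \<in> S" "p \<in> B" for B
    using that dt by (auto simp: t_def split: if_splits)
  have tz: "t B = 0" if "p \<notin> B" "B \<noteq> B0" for B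
    using that M by (auto simp: t_def st_def)
  have "(\<Sum>B\<in>S. t B) = sum t (insert B0 st)"
    by (rule sum.mono_neutral_right) (use finS B0 tz in \<open>auto simp: st_def\<close>)
  also have "\<dots> = 0" using fst B0 tB0 star_sum by (simp add: st_def)
  finally have tot: "(\<Sum>B\<in>S. t B) = 0" .
  have pt: "(\<Sum>B | B \<in> S \<and> i \<in> B. t B) \<noteq> 0 \<and> \<bar>\<Sum>B | B \<in> S \<and> i \<in> B. t B\<bar> \<le> 2"
    if i: "i \<in> {1..n}" for i
  proof (cases "i = p")
    case True
    then show ?thesis using star_sum dt by (auto simp: st_def split: if_splits)
  next
    case False
    obtain C where C: "C \<in> S" "p \<in> C" "i \<in> C" using STS_block_exists[OF S p i] False by auto
    have Cu: "B = C" if "B \<in> S" "p \<in> B" "i \<in> B" for B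
      using STS_block_unique[OF S that C] False by simp
    have CB: "C \<noteq> B0" using C B0 by auto
    show ?thesis
    proof (cases "i \<in> B0")
      case True
      \<comment> \<open>Apart from \<open>B0\<close>, only the block joining \<open>i\<close> to
        \<open>p\<close> has a nonzero label at \<open>i\<close>.\<close>
      have "(\<Sum>B | B \<in> S \<and> i \<in> B. t B) = sum t {C, B0}"
      proof (rule sum.mono_neutral_right)
        show "finite {B. B \<in> S \<and> i \<in> B}" using finS by simp
        show "{C, B0} \<subseteq> {B. B \<in> S \<and> i \<in> B}" using C B0 True by simp
        show "\<forall>B\<in>{B. B \<in> S \<and> i \<in> B} - {C, B0}. t B = 0" using Cu tz by blast
      qed
      also have "\<dots> = d + t0"
      proof -
        have "C \<in> M" using C True M by (auto simp: A_def st_def)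
        then have "t C = d" by (simp add: t_def)
        with CB tB0 show ?thesis by simp
      qed
      finally show ?thesis using dt by (auto split: if_splits)
    next
      case False
      have "(\<Sum>B | B \<in> S \<and> i \<in> B. t B) = sum t {C}"
      proof (rule sum.mono_neutral_right)
        show "finite {B. B \<in> S \<and> i \<in> B}" using finS by simp
        show "{C} \<subseteq> {B. B \<in> S \<and> i \<in> B}" using C by simp
        show "\<forall>B\<in>{B. B \<in> S \<and> i \<in> B} - {C}. t B = 0" using Cu tz False by blast
      qed
      then show ?thesis using t1[OF C(1,2)] by auto
    qed
  qed
  show ?thesis by (rule that[of t]) (use t1 tB0 tz tot pt in auto)
qed

section \<open>Balanced signs on incident point-block pairs\<close>

text \<open>At each point the blocks carrying a sign are even in number, so
  \<open>balanced_signs\<close> applies. Its prescribed value is used at \<open>B0\<close>, which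
  carries a sign at all of its points because it avoids \<open>p\<close>.\<close>

lemma STS_flag_signs:
  assumes S: "steiner_triple_system n S"
    and p: "p \<in> {1..n}" and B0: "B0 \<in> S" "p \<notin> B0" and d: "d = 1 \<or> d = (- 1 :: int)"
  obtains g :: "nat \<Rightarrow> nat set \<Rightarrow> int" where
    "\<And>i. i \<in> {1..n} \<Longrightarrow> (\<Sum>B | B \<in> S \<and> i \<in> B. g i B) = 0"
    "\<And>i B. B \<in> S \<Longrightarrow> i \<in> B \<Longrightarrow> p \<notin> B \<Longrightarrow> g i B = 1 \<or> g i B = - 1"
    "\<And>i B. B \<in> S \<Longrightarrow> i \<in> B \<Longrightarrow> p \<in> B \<Longrightarrow> i \<noteq> p \<Longrightarrow>
       if even (card {B \<in> S. p \<in> B}) then g i B = 1 \<or> g i B = - 1 else g i B = 0"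
    "\<And>B. p \<in> B \<Longrightarrow> g p B = 0"
    "\<And>i. i \<in> B0 \<Longrightarrow> g i B0 = d"
proof -
  have bl: "B \<subseteq> {1..n} \<and> card B = 3" if "B \<in> S" for B
    using S that unfolding steiner_triple_system_def by blast
  have finS: "finite S"
    by (rule finite_subset[of _ "Pow {1..n}"]) (use bl in auto)
  define ev where "ev = even (card {B \<in> S. p \<in> B})"
  \<comment> \<open>The blocks with a nonzero sign at \<open>i\<close>: none through
    \<open>p\<close> when the degree is odd, and none at all at \<open>p\<close> itself.\<close>
  define F where "F i = {B \<in> S. i \<in> B \<and> (p \<notin> B \<or> ev \<and> i \<noteq> p)}" for i
  have fF: "finite (F i)" for i using finS by (simp add: F_def)
  have "even (card (F i))" if i: "i \<in> {1..n}" for i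
  proof (cases "i = p")
    case True
    then have "F i = {}" by (auto simp: F_def)
    then show ?thesis by simp
  next
    case False
    have deg: "card {B \<in> S. i \<in> B} = card {B \<in> S. p \<in> B}"
      using STS_degree[OF S i] STS_degree[OF S p] by simp
    show ?thesis
    proof (cases ev)
      case True
      then have "F i = {B \<in> S. i \<in> B}" using False by (auto simp: F_def)
      then show ?thesis using True deg by (simp add: ev_def)
    next
      case ev: False
      obtain C where C: "C \<in> S" "p \<in> C" "i \<in> C" using STS_block_exists[OF S p i] False by auto
      \<comment> \<open>For odd degree exactly one block, the one joining \<open>i\<close> to
        \<open>p\<close>, is dropped, which leaves an even number.\<close>
      have "{B \<in> S. i \<in> B} = insert C (F i)"
      proof -
        have "B = C" if "B \<in> S" "p \<in> B" "i \<in> B" for B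
          using STS_block_unique[OF S that C] False by simp
        with C ev show ?thesis unfolding F_def by blast
      qed
      moreover have "C \<notin> F i" using ev C by (auto simp: F_def)
      ultimately have "card {B \<in> S. i \<in> B} = Suc (card (F i))" using fF by simp
      then show ?thesis using ev deg by (simp add: ev_def)
    qed
  qed
  then have "\<forall>i\<in>{1..n}. \<exists>e. (\<forall>B. e B = 1 \<or> e B = - 1) \<and> sum e (F i) = 0 \<and> e B0 = d"
    using balanced_signs[OF fF _ d] by blast
  then obtain e where e: "\<And>i. i \<in> {1..n} \<Longrightarrow>
      (\<forall>B. e i B = 1 \<or> e i B = - 1) \<and> sum (e i) (F i) = 0 \<and> e i B0 = d"
    by metis
  define g where "g i B = (if B \<in> F i then e i B else 0)" for i B
  show ?thesis
  proof (rule that[of g])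
    show "(\<Sum>B | B \<in> S \<and> i \<in> B. g i B) = 0" if i: "i \<in> {1..n}" for i
    proof -
      have "(\<Sum>B | B \<in> S \<and> i \<in> B. g i B) = sum (g i) (F i)"
        by (rule sum.mono_neutral_right) (use finS in \<open>auto simp: F_def g_def\<close>)
      also have "\<dots> = sum (e i) (F i)" by (rule sum.cong) (auto simp: g_def)
      finally show ?thesis using e[OF i] by simp
    qed
    show "g i B = 1 \<or> g i B = - 1" if "B \<in> S" "i \<in> B" "p \<notin> B" for i B
    proof -
      have "i \<in> {1..n}" using that bl by blast
      then show ?thesis using that e[of i] by (auto simp: g_def F_def)
    qed
    show "if even (card {B \<in> S. p \<in> B}) then g i B = 1 \<or> g i B = - 1 else g i B = 0"
      if "B \<in> S" "i \<in> B" "p \<in> B" "i \<noteq> p" for i B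
    proof -
      have "i \<in> {1..n}" using that bl by blast
      then show ?thesis using that e[of i] by (auto simp: g_def F_def ev_def)
    qed
    show "g p B = 0" if "p \<in> B" for B using that by (simp add: g_def F_def)
    show "g i B0 = d" if "i \<in> B0" for i
    proof -
      have "i \<in> {1..n}" using that bl B0 by blast
      then show ?thesis using that B0 e[of i] by (auto simp: g_def F_def)
    qed
  qed
qed

section \<open>Assembling the flow and bounding its values\<close>

theorem theorem7:
  fixes N :: nat and S :: "nat set set"
  assumes "assmus_mattson_STS N S" and "N \<ge> 99"
  shows "\<exists>v. zero_sum_flow 5 N S v"
proof -
  obtain n R \<tau> where N: "N = 2 * n + 1" and R: "steiner_triple_system n R"
    and tau: "\<tau> \<in> R \<rightarrow> {0, 1}" and SR: "S = assmus_mattson n R \<tau>"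
    using assms(1) unfolding assmus_mattson_STS_def by blast
  have n: "n \<ge> 49" using N assms(2) by simp
  have bl: "B \<subseteq> {1..n} \<and> card B = 3" if "B \<in> R" for B
    using R that unfolding steiner_triple_system_def by blast
  have p: "1 \<in> {1..n}" using n by simp
  obtain B0 where B0: "B0 \<in> R" "1 \<notin> B0"
    using STS_block_avoiding_1[OF R] n by auto
  define ev where "ev \<longleftrightarrow> even (card {B \<in> R. 1 \<in> B})"
  define d t0 :: int where "d = (if ev then 1 else - 1)" and "t0 = (if ev then - 2 else - 1)"
  have dt: "(d, t0) = (if even (card {B \<in> R. 1 \<in> B}) then (1, - 2) else (- 1, - 1))"
    by (simp add: d_def t0_def ev_def)
  obtain t where t: "\<And>B. B \<in> R \<Longrightarrow> 1 \<in> B \<Longrightarrow> t B = 1 \<or> t B = - 1" "t B0 = t0"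
    "\<And>B. 1 \<notin> B \<Longrightarrow> B \<noteq> B0 \<Longrightarrow> t B = 0" "(\<Sum>B\<in>R. t B) = 0"
    "\<And>i. i \<in> {1..n} \<Longrightarrow>
      (\<Sum>B | B \<in> R \<and> i \<in> B. t B) \<noteq> 0 \<and> \<bar>\<Sum>B | B \<in> R \<and> i \<in> B. t B\<bar> \<le> 2"
    using STS_labelling[OF R _ p B0 dt] n by auto
  define s :: int where "s = (- 1) ^ \<tau> B0"
  have s: "s = 1 \<or> s = - 1" unfolding s_def by (simp add: minus_one_power_iff)
  obtain g where g: "\<And>i. i \<in> {1..n} \<Longrightarrow> (\<Sum>B | B \<in> R \<and> i \<in> B. g i B) = 0"
    "\<And>i B. B \<in> R \<Longrightarrow> i \<in> B \<Longrightarrow> 1 \<notin> B \<Longrightarrow> g i B = 1 \<or> g i B = - 1"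
    "\<And>i B. B \<in> R \<Longrightarrow> i \<in> B \<Longrightarrow> 1 \<in> B \<Longrightarrow> i \<noteq> 1 \<Longrightarrow>
       if ev then g i B = 1 \<or> g i B = - 1 else g i B = 0"
    "\<And>B. 1 \<in> B \<Longrightarrow> g 1 B = 0"
    "\<And>i. i \<in> B0 \<Longrightarrow> g i B0 = s"
    by (rule STS_flag_signs[OF R p B0 s, folded ev_def]) blast
  \<comment> \<open>Since \<open>x * y * z = s\<close>, the signs \<open>x * s\<close>,
    \<open>y * s\<close>, \<open>z * s\<close> have product 1, hence sum 3 or -1. The values are 1,
    -3 for \<open>t0 = - 2\<close> and 2, -2 for \<open>t0 = - 1\<close>.\<close>
  have value_B0: "t0 + x * s + y * s + z * s \<noteq> 0 \<and> \<bar>t0 + x * s + y * s + z * s\<bar> \<le> 4"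
    if "x \<in> {1, - 1}" "y \<in> {1, - 1}" "z \<in> {1, - 1}" "x * y * z = s" for x y z
    using that s by (auto simp: t0_def)
  \<comment> \<open>The term of the point 1 is absent here. What remains is a sum of three signs or,
    for odd degree, the single sign \<open>u\<close>; both are odd and at most 3 in absolute
    value.\<close>
  have value_star: "u + x * a + y * b \<noteq> 0 \<and> \<bar>u + x * a + y * b\<bar> \<le> 4"
    if "u = 1 \<or> u = - 1" "x \<in> {1, - 1}" "y \<in> {1, - 1}"
      "if ev then a = 1 \<or> a = - 1 else a = 0" "if ev then b = 1 \<or> b = - 1 else b = 0"
    for u x y a b :: int
    using that by (auto split: if_splits)
  \<comment> \<open>A sum of three signs is odd, hence nonzero.\<close>
  have value_generic: "x * a + y * b + z * c \<noteq> 0 \<and> \<bar>x * a + y * b + z * c\<bar> \<le> 4"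
    if "x \<in> {1, - 1}" "y \<in> {1, - 1}" "z \<in> {1, - 1}"
      "a = 1 \<or> a = - 1" "b = 1 \<or> b = - 1" "c = 1 \<or> c = - 1"
    for x y z a b c :: int
    using that by auto
  have "zero_sum_flow 5 (2 * n + 1) (assmus_mattson n R \<tau>) (lift_flow n R t g)"
  proof (rule zero_sum_flow_lift_flow[OF bl tau g(1) t(5) t(4)])
    fix i j k :: nat and x y z :: int
    assume B: "{i, j, k} \<in> R" and ne: "i \<noteq> j" "i \<noteq> k" "j \<noteq> k"
      and xyz: "x \<in> {1, - 1}" "y \<in> {1, - 1}" "z \<in> {1, - 1}" "x * y * z = (- 1) ^ \<tau> {i, j, k}"
    let ?B = "{i, j, k}"
    let ?w = "t ?B + x * g i ?B + y * g j ?B + z * g k ?B"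
    consider "?B = B0" | "1 \<in> ?B" | "?B \<noteq> B0" "1 \<notin> ?B" by blast
    then show "?w \<noteq> 0 \<and> \<bar>?w\<bar> \<le> 4"
    proof cases
      case 1
      then have "i \<in> B0" "j \<in> B0" "k \<in> B0" by blast+
      then have e: "g i B0 = s" "g j B0 = s" "g k B0 = s" by (simp_all only: g(5))
      have "x * y * z = s" using xyz(4) unfolding 1 s_def .
      from value_B0[OF xyz(1-3) this] show ?thesis unfolding 1 e t(2) .
    next
      case 2
      have tB: "t ?B = 1 \<or> t ?B = - 1" using t(1)[OF B 2] .
      have one: "g l ?B = 0" if "l = 1" for l using g(4)[OF 2] that by (simp only:)
      have G: "if ev then g l ?B = 1 \<or> g l ?B = - 1 else g l ?B = 0" if "l \<in> ?B" "l \<noteq> 1" for l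
        using g(3)[OF B that(1) 2 that(2)] .
      have m: "i \<in> ?B" "j \<in> ?B" "k \<in> ?B" by blast+
      \<comment> \<open>Exactly one of the three points is 1, and its sign is 0, which leaves the
        situation of \<open>value_star\<close>.\<close>
      from 2 have "i = 1 \<or> j = 1 \<or> k = 1" by blast
      then show ?thesis
      proof (elim disjE)
        assume "i = 1"
        with ne have "j \<noteq> 1" "k \<noteq> 1" by auto
        from value_star[OF tB xyz(2,3) G[OF m(2) this(1)] G[OF m(3) this(2)]]
        show ?thesis unfolding one[OF \<open>i = 1\<close>] mult_zero_right add_0_right .
      next
        assume "j = 1"
        with ne have "i \<noteq> 1" "k \<noteq> 1" by auto
        from value_star[OF tB xyz(1,3) G[OF m(1) this(1)] G[OF m(3) this(2)]]
        show ?thesis unfolding one[OF \<open>j = 1\<close>] mult_zero_right add_0_right .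
      next
        assume "k = 1"
        with ne have "i \<noteq> 1" "j \<noteq> 1" by auto
        from value_star[OF tB xyz(1,2) G[OF m(1) this(1)] G[OF m(2) this(2)]]
        show ?thesis unfolding one[OF \<open>k = 1\<close>] mult_zero_right add_0_right .
      qed
    next
      case 3
      have m: "i \<in> ?B" "j \<in> ?B" "k \<in> ?B" by blast+
      from value_generic[OF xyz(1-3) g(2)[OF B m(1) 3(2)] g(2)[OF B m(2) 3(2)] g(2)[OF B m(3) 3(2)]]
      show ?thesis unfolding t(3)[OF 3(2,1)] add_0_left .
    qed
  qed
  then show ?thesis unfolding N SR by (rule exI[of _ "lift_flow n R t g"])
qed

end
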